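(* Let $n$ be a positive integer, let $r$ be a nonnegative integer and let $k$ be a positive integer with $(r+1)k\le n$. Then $$|\mathcal{I}_k(C_n^r)|=\frac{n}{n-rk}\binom{n-rk}{k}.$$
   Context: $C_n^r$ is the $r$th power of the cycle graph: it has vertex set $\{0,1,\ldots,n-1\}$ and edges $j\sim (j+\ell)\bmod n$ for all $j\in\{0,\ldots,n-1\}$ and all $\ell\in\{1,\ldots,r\}$; $C_n^0$ is the edgeless graph. $\mathcal{I}_k(G)$ is the collection of independent sets of size $k$ of a graph $G$. *)

theory Defs
  imports Complex_Main
begin

(* A graph is a pair of its vertex set and its set of (undirected) edges, an edge being
   the set of its end points. *)
type_synonym 'a graph = "'a set \<times> 'a set set"

abbreviation verts :: "'a graph \<Rightarrow> 'a set" where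
  "verts G \<equiv> fst G"

abbreviation edges :: "'a graph \<Rightarrow> 'a set set" where
  "edges G \<equiv> snd G"

definition adjacent :: "'a graph \<Rightarrow> 'a \<Rightarrow> 'a \<Rightarrow> bool" where
  "adjacent G u v \<longleftrightarrow> {u, v} \<in> edges G"

definition simple_graph :: "'a graph \<Rightarrow> bool" where
  "simple_graph G \<longleftrightarrow> (\<forall>e\<in>edges G. e \<subseteq> verts G \<and> card e = 2)"

definition independent_set :: "'a graph \<Rightarrow> 'a set \<Rightarrow> bool" where
  "independent_set G S \<longleftrightarrow> S \<subseteq> verts G \<and> (\<forall>u\<in>S. \<forall>v\<in>S. \<not> adjacent G u v)"

(* Finiteness is explicit because card is 0 on infinite sets. *)
definition independent_sets :: "nat \<Rightarrow> 'a graph \<Rightarrow> 'a set set" where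
  "independent_sets k G = {S. independent_set G S \<and> finite S \<and> card S = k}"

(* For r >= n > 0 the step l = n would make every vertex adjacent to itself.  This does not
   arise when (r + 1) * k <= n with k positive, since then r < n. *)
definition cycle_power :: "nat \<Rightarrow> nat \<Rightarrow> nat graph" where
  "cycle_power n r = ({0..<n}, {{j, (j + l) mod n} | j l. j \<in> {0..<n} \<and> l \<in> {1..r}})"

lemma cycle_power_simple:
  assumes "r < n"
  shows "simple_graph (cycle_power n r)"
proof -
  have "{j, (j + l) mod n} \<subseteq> {0..<n} \<and> card {j, (j + l) mod n} = 2"
    if "j < n" "1 \<le> l" "l \<le> r" for j l
  proof -
    have "(j + l) mod n \<noteq> j"
    proof (cases "j + l < n")
      case True
      then show ?thesis using that by simp
    next
      case False
      then have "(j + l) mod n = j + l - n"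
        using that assms by (simp add: le_mod_geq)
      then show ?thesis using that assms False by linarith
    qed
    then show ?thesis using that by auto
  qed
  then show ?thesis
    unfolding simple_graph_def cycle_power_def by auto
qed

end

theory Submission
  imports Defs
begin

text \<open>
  Cut the cycle at the arc \<open>A = {n - r..<n}\<close> of \<open>r\<close> consecutive vertices.  Any two vertices of
  \<open>A\<close> are adjacent, so an independent set has at most one vertex in \<open>A\<close>.

  If it has none, it lies in an interval of \<open>n - r\<close> vertices, which is too short for the edges
  that wrap around to matter, and only the linear distances have to exceed \<open>r\<close>.  If its vertex in
  \<open>A\<close> is \<open>x\<close>, the other \<open>k - 1\<close> vertices are subject to the same linear condition inside the
  interval of \<open>n - 2 r - 1\<close> vertices that remains once \<open>x\<close> and its \<open>2 r\<close> neighbours are removed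
  (the empty interval if \<open>n \<le> 2 r\<close>, which forces \<open>k = 1\<close>).

  By \<open>card_sparse_sets\<close> an interval of length \<open>m\<close> has \<open>(m + r - r k) choose k\<close> such \<open>k\<close>-subsets.
  With \<open>M = n - r k\<close> the two cases contribute \<open>M choose k\<close> and \<open>r\<close> times \<open>(M - 1) choose (k - 1)\<close>.
  Since \<open>k (M choose k) = M ((M - 1) choose (k - 1))\<close>, the total is
  \<open>(1 + r k / M) (M choose k) = n / M (M choose k)\<close>.
\<close>

section \<open>Sparse subsets of an interval\<close>

definition sparse :: "nat \<Rightarrow> nat set \<Rightarrow> bool" where
  "sparse r S \<longleftrightarrow> (\<forall>i\<in>S. \<forall>j\<in>S. i < j \<longrightarrow> i + r < j)"

definition sparse_sets :: "nat \<Rightarrow> nat \<Rightarrow> nat set \<Rightarrow> nat set set" where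
  "sparse_sets r k A = {S. S \<subseteq> A \<and> sparse r S \<and> card S = k}"

lemma finite_sparse_sets: "finite A \<Longrightarrow> finite (sparse_sets r k A)"
  unfolding sparse_sets_def by (rule finite_subset[of _ "Pow A"]) auto

lemma sparse_sets_0:
  assumes "finite A"
  shows "sparse_sets r 0 A = {{}}"
  using assms by (auto simp: sparse_sets_def sparse_def dest: finite_subset)

lemma card_image_insert:
  assumes "\<And>T. T \<in> F \<Longrightarrow> x \<notin> T"
  shows "card (insert x ` F) = card F"
  using assms by (intro card_image inj_onI) (metis insert_ident)

text \<open>
  The two parts are the sets without and with the last point of the interval; the last point
  excludes the \<open>r\<close> points before it.  When \<open>m < r\<close> the truncated difference \<open>m - r\<close> leaves the
  empty interval, as it should.
\<close>

lemma sparse_sets_Suc: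
  "sparse_sets r (Suc k) {a..<a + Suc m} =
     sparse_sets r (Suc k) {a..<a + m} \<union> insert (a + m) ` sparse_sets r k {a..<a + (m - r)}"
    (is "?L = ?R1 \<union> ?R2")
proof (intro equalityI subsetI)
  fix S assume S: "S \<in> ?L"
  then have sub: "S \<subseteq> {a..<a + Suc m}" and sp: "sparse r S" and c: "card S = Suc k"
    by (auto simp: sparse_sets_def)
  show "S \<in> ?R1 \<union> ?R2"
  proof (cases "a + m \<in> S")
    case True
    have "S - {a + m} \<subseteq> {a..<a + (m - r)}"
    proof
      fix y assume y: "y \<in> S - {a + m}"
      then have "a \<le> y" "y < a + m" using sub by fastforce+
      moreover from this have "y + r < a + m" using sp y True by (auto simp: sparse_def)
      ultimately show "y \<in> {a..<a + (m - r)}" by auto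
    qed
    moreover have "card (S - {a + m}) = k" using c True by simp
    moreover have "sparse r (S - {a + m})" using sp by (auto simp: sparse_def)
    ultimately have "S - {a + m} \<in> sparse_sets r k {a..<a + (m - r)}"
      by (simp add: sparse_sets_def)
    moreover have "S = insert (a + m) (S - {a + m})" using True by blast
    ultimately show ?thesis by blast
  next
    case False
    then have "S \<subseteq> {a..<a + m}" using sub by (fastforce simp: less_Suc_eq)
    then show ?thesis using sp c by (simp add: sparse_sets_def)
  qed
next
  fix S assume "S \<in> ?R1 \<union> ?R2"
  then show "S \<in> ?L"
  proof
    assume "S \<in> ?R1"
    then show ?thesis by (auto simp: sparse_sets_def)
  next
    assume "S \<in> ?R2"
    then obtain T where S: "S = insert (a + m) T" and sub: "T \<subseteq> {a..<a + (m - r)}"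
      and sp: "sparse r T" and c: "card T = k"
      by (auto simp: sparse_sets_def)
    have lt: "a \<le> y \<and> y + r < a + m" if "y \<in> T" for y using sub that by fastforce
    have "a + m \<notin> T" using lt by fastforce
    moreover have "finite T" using sub by (rule finite_subset) simp
    ultimately have "card S = Suc k" using S c by simp
    moreover have "S \<subseteq> {a..<a + Suc m}" using S lt by fastforce
    moreover have "sparse r S" using sp lt unfolding S sparse_def by fastforce
    ultimately show ?thesis by (simp add: sparse_sets_def)
  qed
qed

text \<open>
  The recursion matches Pascal's rule.  The formula covers intervals too short for any such set:
  if \<open>r k > m + r\<close> then \<open>k > 1\<close>, the truncated upper index is \<open>0\<close>, and both sides vanish.
\<close>

lemma card_sparse_sets:
  "card (sparse_sets r k {a..<a + m}) = (m + r - r * k) choose k"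
proof (induction m arbitrary: k rule: less_induct)
  case (less m)
  show ?case
  proof (cases k)
    case 0
    then show ?thesis by (simp add: sparse_sets_0)
  next
    case k: (Suc k')
    show ?thesis
    proof (cases m)
      case 0
      have "sparse_sets r (Suc k') {} = {}" by (auto simp: sparse_sets_def)
      then show ?thesis using 0 k by simp
    next
      case m: (Suc m')
      let ?A = "sparse_sets r (Suc k') {a..<a + m'}"
      let ?B = "insert (a + m') ` sparse_sets r k' {a..<a + (m' - r)}"
      have "card (sparse_sets r k {a..<a + m}) = card (?A \<union> ?B)"
        using sparse_sets_Suc[of r k' a m'] by (simp only: k m)
      also have "\<dots> = card ?A + card ?B"
        by (rule card_Un_disjoint) (auto simp: finite_sparse_sets, auto simp: sparse_sets_def)
      also have "card ?B = card (sparse_sets r k' {a..<a + (m' - r)})"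
        by (rule card_image_insert) (auto simp: sparse_sets_def)
      also have "card ?A = (m' - r * k') choose Suc k'"
        using less.IH[of m' "Suc k'"] m by simp
      also have "card (sparse_sets r k' {a..<a + (m' - r)}) = (m' - r + r - r * k') choose k'"
        using less.IH[of "m' - r" k'] m by simp
      also have "\<dots> = (m' - r * k') choose k'"
        by (cases k'; cases "r \<le> m'") auto
      also have "((m' - r * k') choose Suc k') + ((m' - r * k') choose k')
          = (Suc m' - r * k') choose Suc k'"
      proof (cases "r * k' \<le> m'")
        case True
        then show ?thesis by (simp add: Suc_diff_le)
      next
        case False
        then show ?thesis by (cases k') auto
      qed
      finally show ?thesis by (simp add: k m)
    qed
  qed
qed

section \<open>Independent sets of powers of cycles\<close>

lemma adjacent_cycle_power:
  assumes "r < n" "u < v" "v < n"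
  shows "adjacent (cycle_power n r) u v \<longleftrightarrow> v \<le> u + r \<or> u + n \<le> v + r"
proof
  assume "adjacent (cycle_power n r) u v"
  then obtain j l where jl: "{u, v} = {j, (j + l) mod n}" "j < n" "1 \<le> l" "l \<le> r"
    by (auto simp: adjacent_def cycle_power_def)
  have "(j + l) mod n = j + l \<or> (j + l) mod n = j + l - n \<and> n \<le> j + l"
    using jl assms by (cases "j + l < n") (simp_all add: le_mod_geq)
  moreover have "u = j \<and> v = (j + l) mod n \<or> v = j \<and> u = (j + l) mod n"
    using jl(1) by (auto simp: doubleton_eq_iff)
  ultimately show "v \<le> u + r \<or> u + n \<le> v + r"
    using jl assms by linarith
next
  assume "v \<le> u + r \<or> u + n \<le> v + r"
  then show "adjacent (cycle_power n r) u v"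
  proof
    assume "v \<le> u + r"
    then have "{u, v} = {u, (u + (v - u)) mod n} \<and> u \<in> {0..<n} \<and> v - u \<in> {1..r}"
      using assms by auto
    then show ?thesis unfolding adjacent_def cycle_power_def snd_conv by blast
  next
    assume "u + n \<le> v + r"
    then have "{u, v} = {v, (v + (u + n - v)) mod n} \<and> v \<in> {0..<n} \<and> u + n - v \<in> {1..r}"
      using assms by auto
    then show ?thesis unfolding adjacent_def cycle_power_def snd_conv by blast
  qed
qed

lemma independent_set_cycle_power:
  assumes "r < n"
  shows "independent_set (cycle_power n r) S \<longleftrightarrow>
    S \<subseteq> {0..<n} \<and> (\<forall>i\<in>S. \<forall>j\<in>S. i < j \<longrightarrow> i + r < j \<and> j + r < i + n)" (is "?I \<longleftrightarrow> ?R")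
proof
  assume I: ?I
  then have sub: "S \<subseteq> {0..<n}" by (simp add: independent_set_def cycle_power_def)
  have "i + r < j \<and> j + r < i + n" if "i \<in> S" "j \<in> S" "i < j" for i j
  proof -
    have "j < n" using sub that by auto
    moreover have "\<not> adjacent (cycle_power n r) i j"
      using I that by (simp add: independent_set_def)
    ultimately show ?thesis using adjacent_cycle_power[OF assms \<open>i < j\<close>] by auto
  qed
  with sub show ?R by blast
next
  assume R: ?R
  have irrefl: "\<not> adjacent (cycle_power n r) u u" for u
    using cycle_power_simple[OF assms] by (fastforce simp: simple_graph_def adjacent_def)
  have sym: "adjacent (cycle_power n r) u v \<longleftrightarrow> adjacent (cycle_power n r) v u" for u v
    by (simp add: adjacent_def insert_commute)
  have less: "\<not> adjacent (cycle_power n r) u v" if "u \<in> S" "v \<in> S" "u < v" for u v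
  proof -
    have "v < n" "u + r < v" "v + r < u + n" using R that by auto
    then show ?thesis using adjacent_cycle_power[OF assms \<open>u < v\<close>] by simp
  qed
  have "\<not> adjacent (cycle_power n r) u v" if "u \<in> S" "v \<in> S" for u v
    using less[of u v] less[of v u] irrefl sym that by (metis linorder_neqE_nat)
  then show ?I using R by (auto simp: independent_set_def cycle_power_def)
qed

lemma independent_sets_cycle_power:
  assumes "r < n"
  shows "independent_sets k (cycle_power n r) =
    {S. S \<subseteq> {0..<n} \<and> (\<forall>i\<in>S. \<forall>j\<in>S. i < j \<longrightarrow> i + r < j \<and> j + r < i + n) \<and> card S = k}"
  unfolding independent_sets_def independent_set_cycle_power[OF assms]
  by (auto intro: finite_subset)

lemma independent_sets_avoiding_arc:
  assumes "r < n"
  shows "{S \<in> independent_sets k (cycle_power n r). S \<inter> {n - r..<n} = {}} =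
    sparse_sets r k {0..<n - r}" (is "?L = ?R")
proof (intro equalityI subsetI)
  fix S assume S: "S \<in> ?L"
  have "S \<subseteq> {0..<n - r}"
  proof
    fix y assume "y \<in> S"
    then have "y < n" "y \<notin> {n - r..<n}"
      using S by (auto simp: independent_sets_cycle_power[OF assms])
    then show "y \<in> {0..<n - r}" by auto
  qed
  then show "S \<in> ?R"
    using S by (auto simp: independent_sets_cycle_power[OF assms] sparse_sets_def sparse_def)
next
  fix S assume S: "S \<in> ?R"
  then have lt: "y + r < n" if "y \<in> S" for y
    using that by (fastforce simp: sparse_sets_def)
  then have "S \<inter> {n - r..<n} = {}" by fastforce
  then show "S \<in> ?L"
    using S lt
    by (fastforce simp: independent_sets_cycle_power[OF assms] sparse_sets_def sparse_def)
qed

text \<open>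
  The vertices that are neither \<open>x\<close> nor adjacent to \<open>x\<close> are those from \<open>x + r + 1 - n\<close> up to \<open>x - r - 1\<close>; as \<open>x\<close> lies in
  the last \<open>r\<close> positions, none of them comes after \<open>x\<close>.
\<close>

lemma independent_sets_meeting_arc:
  assumes "r < n" and x: "x \<in> {n - r..<n}"
  shows "{S \<in> independent_sets (Suc k) (cycle_power n r). x \<in> S} =
    insert x ` sparse_sets r k {x + r + 1 - n..<x + r + 1 - n + (n - (2 * r + 1))}"
    (is "?L = insert x ` ?R")
proof (intro equalityI subsetI)
  fix S assume "S \<in> ?L"
  then have sub: "S \<subseteq> {0..<n}" and c: "card S = Suc k" and xS: "x \<in> S"
    and ind: "\<And>i j. i \<in> S \<Longrightarrow> j \<in> S \<Longrightarrow> i < j \<Longrightarrow> i + r < j \<and> j + r < i + n"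
    by (auto simp: independent_sets_cycle_power[OF assms(1)])
  have "S - {x} \<subseteq> {x + r + 1 - n..<x + r + 1 - n + (n - (2 * r + 1))}"
  proof
    fix y assume y: "y \<in> S - {x}"
    then have "y < n" using sub by auto
    then have "y < x" using ind[of x y] xS y x by fastforce
    then have "y + r < x" "x + r < y + n" using ind[of y x] xS y by auto
    then show "y \<in> {x + r + 1 - n..<x + r + 1 - n + (n - (2 * r + 1))}" using x by auto
  qed
  moreover have "sparse r (S - {x})" using ind by (auto simp: sparse_def)
  moreover have "card (S - {x}) = k" using c xS by simp
  ultimately have "S - {x} \<in> ?R" by (simp add: sparse_sets_def)
  moreover have "S = insert x (S - {x})" using xS by blast
  ultimately show "S \<in> insert x ` ?R" by blast
next
  fix S assume "S \<in> insert x ` ?R"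
  then obtain T where S: "S = insert x T" and sp: "sparse r T" and c: "card T = k"
    and sub: "T \<subseteq> {x + r + 1 - n..<x + r + 1 - n + (n - (2 * r + 1))}"
    by (auto simp: sparse_sets_def)
  have T: "y + r < x \<and> x + r < y + n" if "y \<in> T" for y
  proof -
    have "x + r + 1 - n \<le> y" "y < x + r + 1 - n + (n - (2 * r + 1))"
      using sub that by fastforce+
    then show ?thesis using x by auto
  qed
  have "x \<notin> T" using T by fastforce
  moreover have "finite T" using sub by (rule finite_subset) simp
  ultimately have "card S = Suc k" using S c by simp
  moreover have "S \<subseteq> {0..<n}" using S T x by fastforce
  moreover have "i + r < j \<and> j + r < i + n" if "i \<in> S" "j \<in> S" "i < j" for i j
  proof -
    have "i \<in> T"
      using S T[of j] that by auto
    show ?thesis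
    proof (cases "j = x")
      case True
      then show ?thesis using T[OF \<open>i \<in> T\<close>] by simp
    next
      case False
      then have "j \<in> T" using S that by simp
      then have "i + r < j" using sp \<open>i \<in> T\<close> that by (simp add: sparse_def)
      then show ?thesis using T[OF \<open>j \<in> T\<close>] x by auto
    qed
  qed
  ultimately show "S \<in> ?L" using S by (simp add: independent_sets_cycle_power[OF assms(1)])
qed

lemma card_independent_sets_meeting_arc:
  assumes "(r + 1) * Suc k \<le> n" and x: "x \<in> {n - r..<n}"
  shows "card {S \<in> independent_sets (Suc k) (cycle_power n r). x \<in> S} =
    (n - r * Suc k - 1) choose k"
proof -
  have rn: "r < n" using assms(1) by simp
  have "card {S \<in> independent_sets (Suc k) (cycle_power n r). x \<in> S} =
      card (sparse_sets r k {x + r + 1 - n..<x + r + 1 - n + (n - (2 * r + 1))})"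
    unfolding independent_sets_meeting_arc[OF rn x]
  proof (rule card_image_insert)
    have "x \<notin> {x + r + 1 - n..<x + r + 1 - n + (n - (2 * r + 1))}"
      using x rn unfolding atLeastLessThan_iff by linarith
    then show "x \<notin> T"
      if "T \<in> sparse_sets r k {x + r + 1 - n..<x + r + 1 - n + (n - (2 * r + 1))}" for T
      using that unfolding sparse_sets_def by blast
  qed
  also have "\<dots> = (n - (2 * r + 1) + r - r * k) choose k"
    by (rule card_sparse_sets)
  also have "\<dots> = (n - r * Suc k - 1) choose k"
  (* For k = 0 the difference n - (2 r + 1) may be truncated, but the lower index is then 0. *)
  proof (cases k)
    case (Suc k')
    then have "2 * r + 1 \<le> n" using assms(1) by simp
    then have "n - (2 * r + 1) + r - r * k = n - r * Suc k - 1" by simp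
    then show ?thesis by simp
  qed simp
  finally show ?thesis .
qed

lemma card_independent_sets_cycle_power:
  assumes "(r + 1) * Suc k \<le> n"
  shows "card (independent_sets (Suc k) (cycle_power n r)) =
    ((n - r * Suc k) choose Suc k) + r * ((n - r * Suc k - 1) choose k)"
proof -
  have rn: "r < n" using assms by simp
  define I where "I = independent_sets (Suc k) (cycle_power n r)"
  define A where "A = {n - r..<n}"
  have fin: "finite I"
    unfolding I_def independent_sets_cycle_power[OF rn]
    by (rule finite_subset[of _ "Pow {0..<n}"]) auto
  have unique: "x = y" if "S \<in> I" "x \<in> S" "y \<in> S" "x \<in> A" "y \<in> A" for S x y
  proof (rule ccontr)
    have close: False if "u \<in> S" "v \<in> S" "u \<in> A" "v \<in> A" "u < v" for u v
      using \<open>S \<in> I\<close> that unfolding I_def A_def independent_sets_cycle_power[OF rn] by fastforce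
    assume "x \<noteq> y"
    then show False using close[of x y] close[of y x] that by (metis linorder_neqE_nat)
  qed
  have "I = {S \<in> I. S \<inter> A = {}} \<union> (\<Union>x\<in>A. {S \<in> I. x \<in> S})" by blast
  then have "card I = card ({S \<in> I. S \<inter> A = {}} \<union> (\<Union>x\<in>A. {S \<in> I. x \<in> S}))"
    by simp
  also have "\<dots> = card {S \<in> I. S \<inter> A = {}} + card (\<Union>x\<in>A. {S \<in> I. x \<in> S})"
    by (rule card_Un_disjoint) (auto simp: fin A_def)
  also have "card (\<Union>x\<in>A. {S \<in> I. x \<in> S}) = (\<Sum>x\<in>A. card {S \<in> I. x \<in> S})"
    by (rule card_UN_disjoint) (auto simp: fin A_def intro: unique[unfolded A_def])
  also have "\<dots> = (\<Sum>x\<in>A. (n - r * Suc k - 1) choose k)"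
    using card_independent_sets_meeting_arc[OF assms] by (intro sum.cong) (auto simp: I_def A_def)
  also have "\<dots> = r * ((n - r * Suc k - 1) choose k)"
    using rn by (simp add: A_def)
  also have "card {S \<in> I. S \<inter> A = {}} = (n - r * Suc k) choose Suc k"
    using card_sparse_sets[of r "Suc k" 0 "n - r"] rn
    by (simp add: I_def A_def independent_sets_avoiding_arc[OF rn])
  finally show ?thesis by (simp add: I_def)
qed

theorem mainTheorem2:
  fixes n r k :: nat
  assumes "n > 0" and "k > 0" and "(r + 1) * k \<le> n"
  shows "real (card (independent_sets k (cycle_power n r)))
    = real n / real (n - r * k) * real ((n - r * k) choose k)"
proof -
  define M where "M = n - r * k"
  obtain k' where k: "k = Suc k'" using assms(2) by (cases k) auto
  have le: "r * k + k \<le> n" using assms(3) by (simp add: algebra_simps)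
  then have M: "M > 0" "n = M + r * k" using assms(2) by (auto simp: M_def)
  have "k * (M choose k) = M * ((M - 1) choose k')"
    using M(1) k Suc_times_binomial[of k' "M - 1"] by simp
  then have absorb: "real k * real (M choose k) = real M * real ((M - 1) choose k')"
    by (metis of_nat_mult)
  have "card (independent_sets k (cycle_power n r)) =
      (M choose k) + r * ((M - 1) choose k')"
    using card_independent_sets_cycle_power[of r k' n] assms(3) unfolding M_def k by simp
  then have "real M * real (card (independent_sets k (cycle_power n r))) =
      real M * real (M choose k) + real r * (real M * real ((M - 1) choose k'))"
    by (simp add: algebra_simps)
  also have "\<dots> = real n * real (M choose k)"
    unfolding absorb[symmetric] M(2) by (simp add: algebra_simps)
  finally show ?thesis
    using M(1) unfolding M_def[symmetric] by (simp add: field_simps)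
qed

end
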